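(* For every integer $n\geq 0$, (i) $c(n)=b_{6,ee}(n)$; (ii) $d(n)=b_{6,eo}(n+2)$.
   Context: A partition is called $6$-regular if none of its parts is divisible by $6$. $b_{6,ee}(n)$ (respectively $b_{6,eo}(n)$) denotes the number of $6$-regular partitions of $n$ with an even (respectively odd) number of even parts, where parts are counted with multiplicity. $c(n)$ denotes the number of partitions of $n$ into parts which are not congruent to $0,\pm 2,\pm 20,\pm 22,24$ modulo $48$. $d(n)$ denotes the number of partitions of $n$ into parts which are not congruent to $0,\pm 4,\pm 10,\pm 14,24$ modulo $48$. The empty partition is the only partition of $0$ and has $0$ even parts. *)

theory Defs
  imports "HOL-Library.Multiset" "HOL-Number_Theory.Cong"
begin

definition partitions_of :: "nat \<Rightarrow> nat multiset set" where
  "partitions_of n = {p. 0 \<notin># p \<and> sum_mset p = n}"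

(* Counting partitions with card is only meaningful because there are finitely many of them. *)
lemma finite_partitions_of: "finite (partitions_of n)"
proof -
  have size_le: "size p \<le> sum_mset p" if "0 \<notin># p" for p :: "nat multiset"
    using that by (induction p) auto
  have "partitions_of n \<subseteq> mset ` {xs. set xs \<subseteq> {..n} \<and> length xs \<le> n}"
  proof
    fix p assume p: "p \<in> partitions_of n"
    obtain xs where xs: "mset xs = p"
      using ex_mset by blast
    have "k \<le> n" if "k \<in># p" for k
      using p sum_mset.remove[OF that] by (simp add: partitions_of_def)
    moreover have "size p \<le> n"
      using p size_le[of p] by (simp add: partitions_of_def)
    ultimately have "xs \<in> {xs. set xs \<subseteq> {..n} \<and> length xs \<le> n}"
      using xs by auto
    then show "p \<in> mset ` {xs. set xs \<subseteq> {..n} \<and> length xs \<le> n}"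
      using xs by blast
  qed
  then show ?thesis
    by (rule finite_subset) (simp add: finite_lists_length_le)
qed

definition regular :: "nat \<Rightarrow> nat multiset \<Rightarrow> bool" where
  "regular l p \<longleftrightarrow> (\<forall>k\<in>#p. \<not> l dvd k)"

definition num_even_parts :: "nat multiset \<Rightarrow> nat" where
  "num_even_parts p = size (filter_mset even p)"

definition b_ee :: "nat \<Rightarrow> nat \<Rightarrow> nat" where
  "b_ee l n = card {p \<in> partitions_of n. regular l p \<and> even (num_even_parts p)}"

definition b_eo :: "nat \<Rightarrow> nat \<Rightarrow> nat" where
  "b_eo l n = card {p \<in> partitions_of n. regular l p \<and> odd (num_even_parts p)}"

(* The residues are integers so that -r can be written for the negative residue classes. *)
definition parts_avoid :: "int \<Rightarrow> int set \<Rightarrow> nat multiset \<Rightarrow> bool" where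
  "parts_avoid m R p \<longleftrightarrow> (\<forall>k\<in>#p. \<forall>r\<in>R. \<not> [int k = r] (mod m))"

definition c :: "nat \<Rightarrow> nat" where
  "c n = card {p \<in> partitions_of n.
     parts_avoid 48 {0, 2, -2, 20, -20, 22, -22, 24} p}"

definition d :: "nat \<Rightarrow> nat" where
  "d n = card {p \<in> partitions_of n.
     parts_avoid 48 {0, 4, -4, 10, -10, 14, -14, 24} p}"

end

(*
  Write y = x^2. Multiplied by (x;x), the generating functions of the 6-regular partitions,
  counted with weight 1 and with sign (-1)^(number of even parts), become
    (y^3;y^3)   and   (y^3;y^3) (y,y^2;y^3) (y,y^5;y^6),
  while those of c and d become
    P = (y,y^10,y^11,y^12,y^13,y^14,y^23,y^24;y^24)   and
    Q = (y^2,y^5,y^7,y^12,y^17,y^19,y^22,y^24;y^24).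
  All four are one-variable theta series: the first by the Jacobi triple product (Euler's
  pentagonal number theorem), the others by the quintuple product with (base, z) equal to
  (y^3, y), (y^12, y) and (y^12, y^5). Splitting the first two series into even and odd
  indices gives P + y Q and P - y Q, so that b_ee and b_eo, being half the sum and half the
  difference, have generating functions P/(x;x) and y Q/(x;x). The products are treated as real
  functions on (0,1), where a power series is determined by its values.
*)
theory Submission
  imports Defs "HOL-Complex_Analysis.Cauchy_Integral_Formula"
begin

section \<open>Dominated convergence and products of infinite sums\<close>

text \<open>An infinite sum is an integral for the counting measure, so Lebesgue's dominated
  convergence theorem applies. It carries both limits below: from the finite to the infinite triple
  product, and from finitely many part sizes to all of them.\<close>

lemma tendsto_infsum_dominated:
  fixes f :: "nat \<Rightarrow> 'a \<Rightarrow> real"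
  assumes lim: "\<And>k. k \<in> A \<Longrightarrow> (\<lambda>n. f n k) \<longlonglongrightarrow> g k"
    and bound: "\<And>n k. k \<in> A \<Longrightarrow> \<bar>f n k\<bar> \<le> h k"
    and h: "h summable_on A"
  shows "g summable_on A" and "(\<lambda>n. infsum (f n) A) \<longlonglongrightarrow> infsum g A"
proof -
  have h': "integrable (count_space A) h"
    using h by (metis abs_summable_equivalent abs_summable_on_def summable_on_iff_abs_summable_on_real)
  have int: "integrable (count_space A) g" "\<And>n. integrable (count_space A) (f n)"
    "(\<lambda>n. integral\<^sup>L (count_space A) (f n)) \<longlonglongrightarrow> integral\<^sup>L (count_space A) g"
    by (rule integrable_dominated_convergence[where w = h and s = f]
        integrable_dominated_convergence2[where w = h and s = f and f = g]
        integral_dominated_convergence[where w = h];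
        use h' lim bound in \<open>auto simp: AE_count_space\<close>)+
  \<comment> \<open>Real families are summable exactly if they are absolutely summable; this
    identifies \<open>infsum\<close> with the integral.\<close>
  have conv: "u summable_on A \<and> integral\<^sup>L (count_space A) u = infsum u A"
    if "integrable (count_space A) u" for u :: "'a \<Rightarrow> real"
    using that by (metis abs_summable_equivalent abs_summable_on_def infsetsum_def infsetsum_infsum
        summable_on_iff_abs_summable_on_real)
  show "g summable_on A" using conv int(1) by blast
  show "(\<lambda>n. infsum (f n) A) \<longlonglongrightarrow> infsum g A"
    using int(3) conv int(1,2) by auto
qed

text \<open>Real unconditional sums converge absolutely, so the product family is summable over the
  pairs and may be summed row by row.\<close>

lemma has_sum_prod_real:
  fixes f :: "'a \<Rightarrow> real" and g :: "'b \<Rightarrow> real"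
  assumes "(f has_sum a) A" "(g has_sum b) B"
  shows "((\<lambda>(i, j). f i * g j) has_sum (a * b)) (A \<times> B)"
proof -
  have "(\<lambda>i. \<bar>f i\<bar>) summable_on A" "(\<lambda>j. \<bar>g j\<bar>) summable_on B"
    using assms[THEN has_sum_imp_summable]
    by (auto simp flip: real_norm_def summable_on_iff_abs_summable_on_real)
  hence "(\<lambda>p. norm (f (fst p) * g (snd p))) summable_on (A \<times> B)"
    by (intro iffD2[OF Infinite_Sum.abs_summable_on_Sigma_iff])
       (auto simp: abs_mult infsum_cmult_right' intro!: summable_on_cmult_right summable_on_cmult_left
         infsum_nonneg)
  hence "(\<lambda>(i, j). f i * g j) summable_on (A \<times> B)"
    by (subst summable_on_iff_abs_summable_on_real) (simp add: case_prod_unfold)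
  thus ?thesis
    by (intro has_sum_SigmaI[where g = "\<lambda>i. f i * b"])
       (use assms in \<open>auto intro: has_sum_cmult_right has_sum_cmult_left\<close>)
qed

section \<open>q-Pochhammer symbols\<close>

text \<open>The infinite symbol (a; q) of the opening comment, where (a, b; q) abbreviates (a; q)
  (b; q).\<close>

definition qpoch :: "real \<Rightarrow> real \<Rightarrow> real" where
  "qpoch a q = (\<Prod>k. 1 - a * q ^ k)"

lemma summable_qpoch:
  fixes a q :: real
  assumes "0 \<le> q" "q < 1"
  shows "summable (\<lambda>k. \<bar>1 - a * q ^ k - 1\<bar>)"
  using assms by (auto simp: abs_mult intro!: summable_mult summable_geometric)

lemma convergent_qpoch:
  fixes a q :: real
  assumes "0 \<le> q" "q < 1"
  shows "convergent_prod (\<lambda>k. 1 - a * q ^ k)"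
  using summable_qpoch[OF assms, of a]
  by (intro abs_convergent_prod_imp_convergent_prod summable_imp_abs_convergent_prod) simp

lemma qpoch_LIMSEQ:
  assumes "0 \<le> q" "q < 1"
  shows "(\<lambda>n. \<Prod>k<n. 1 - a * q ^ k) \<longlonglongrightarrow> qpoch a q"
  using convergent_prod_LIMSEQ[OF convergent_qpoch[OF assms, of a]]
  by (simp add: qpoch_def LIMSEQ_lessThan_iff_atMost)

lemma qpoch_0 [simp]: "qpoch 0 q = 1"
  by (simp add: qpoch_def)

text \<open>Convergence of an infinite product of nonzero factors includes that its limit is
  nonzero, so positive factors give a positive value. This permits the later cancellations.\<close>

lemma qpoch_pos:
  assumes "0 \<le> q" "q < 1" "a < 1"
  shows "0 < qpoch a q"
proof -
  have "a * q ^ k < 1" for k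
  proof (cases "a \<le> 0")
    case True
    then show ?thesis using assms by (smt (verit) mult_nonpos_nonneg zero_le_power)
  next
    case False
    then show ?thesis using assms power_le_one[of q k]
      by (smt (verit) mult_left_le)
  qed
  then show ?thesis unfolding qpoch_def
    by (intro less_0_prodinf convergent_qpoch assms) auto
qed

text \<open>The factor at k = 0 vanishes. This annihilates one of three series in the quintuple
  product.\<close>

lemma qpoch_1: 
  assumes "0 \<le> q" "q < 1"
  shows "qpoch 1 q = 0"
proof -
  have "(\<lambda>n. \<Prod>k<Suc n. 1 - 1 * q ^ k) \<longlonglongrightarrow> qpoch 1 q"
    using LIMSEQ_Suc[OF qpoch_LIMSEQ[OF assms, of 1]] by simp
  moreover have "(\<Prod>k<Suc n. 1 - 1 * q ^ k) = 0" for n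
    by (subst prod.lessThan_Suc_shift) simp
  ultimately show ?thesis by (simp only: LIMSEQ_const_iff)
qed

text \<open>The first \<open>m * n\<close> factors regroup into m partial products of n factors
  each. Absolute convergence passes to every residue class, so both sides have limits.\<close>

lemma prodinf_split_mod:
  fixes f :: "nat \<Rightarrow> real"
  assumes f: "summable (\<lambda>k. \<bar>f k - 1\<bar>)" and m: "m > 0"
  shows "prodinf f = (\<Prod>r<m. \<Prod>j. f (m * j + r))"
proof -
  have conv: "convergent_prod f"
    using f by (intro abs_convergent_prod_imp_convergent_prod summable_imp_abs_convergent_prod) simp
  have conv': "convergent_prod (\<lambda>j. f (m * j + r))" for r
  proof -
    have "(\<lambda>k. \<bar>f k - 1\<bar>) summable_on UNIV"
      using f by (simp add: summable_on_UNIV_nonneg_real_iff)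
    hence "(\<lambda>k. \<bar>f k - 1\<bar>) summable_on range (\<lambda>j. m * j + r)"
      by (rule summable_on_subset) auto
    hence "(\<lambda>j. \<bar>f (m * j + r) - 1\<bar>) summable_on UNIV"
      using m by (subst (asm) summable_on_reindex) (auto simp: inj_on_def o_def)
    hence "summable (\<lambda>j. \<bar>f (m * j + r) - 1\<bar>)"
      by (simp add: summable_on_UNIV_nonneg_real_iff)
    thus ?thesis
      by (intro abs_convergent_prod_imp_convergent_prod summable_imp_abs_convergent_prod) simp
  qed
  have lim: "(\<lambda>n. \<Prod>k<n. g k) \<longlonglongrightarrow> prodinf g" if "convergent_prod g" for g :: "nat \<Rightarrow> real"
    using convergent_prod_LIMSEQ[OF that] by (simp add: LIMSEQ_lessThan_iff_atMost)
  have "(\<lambda>n. \<Prod>r<m. \<Prod>j<n. f (m * j + r)) \<longlonglongrightarrow> (\<Prod>r<m. \<Prod>j. f (m * j + r))"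
    by (intro tendsto_prod lim conv')
  moreover have "(\<Prod>r<m. \<Prod>j<n. f (m * j + r)) = (\<Prod>k<m*n. f k)" for n
  proof -
    have "(\<Prod>r<m. \<Prod>j<n. f (m * j + r)) = (\<Prod>j<n. \<Prod>r<m. f (m * j + r))"
      by (rule prod.swap)
    also have "\<dots> = (\<Prod>j<n. prod f {j * m..<j * m + m})"
    proof (rule prod.cong[OF refl])
      fix j
      show "(\<Prod>r<m. f (m * j + r)) = prod f {j * m..<j * m + m}"
        using prod.shift_bounds_nat_ivl[of f 0 "j * m" m]
        by (simp add: lessThan_atLeast0 ac_simps)
    qed
    also have "\<dots> = (\<Prod>k<m*n. f k)"
      by (simp add: prod.nat_group mult.commute)
    finally show ?thesis .
  qed
  moreover have "(\<lambda>n. \<Prod>k<m*n. f k) \<longlonglongrightarrow> prodinf f"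
    using LIMSEQ_subseq_LIMSEQ[OF lim[OF conv], of "\<lambda>n. m * n"] m
    by (auto simp: strict_mono_def o_def)
  ultimately show ?thesis
    using LIMSEQ_unique by fastforce
qed

lemma qpoch_split:
  assumes q: "0 \<le> q" "q < 1" and m: "m > 0"
  shows "qpoch a q = (\<Prod>r<m. qpoch (a * q ^ r) (q ^ m))"
  unfolding qpoch_def
  by (subst prodinf_split_mod[OF summable_qpoch[OF q] m])
     (simp add: power_add mult_ac flip: power_mult)

lemma qpoch_minus:
  assumes q: "0 \<le> q" "q < 1"
  shows "qpoch a q * qpoch (- a) q = qpoch (a\<^sup>2) (q\<^sup>2)"
  unfolding qpoch_def
  by (subst prodinf_mult) 
     (use convergent_qpoch[OF q, of a] convergent_qpoch[OF q, of "-a"]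
      in \<open>auto simp: algebra_simps power2_eq_square power_mult_distrib\<close>)

section \<open>The Jacobi triple product\<close>

text \<open>For n > 0 the term is the n-th power of \<open>a * p ^ (n - 1)\<close>, which eventually
  drops below 1/2, so a geometric series dominates.\<close>

lemma summable_theta_nat:
  fixes a p :: real
  assumes "0 < a" "0 < p" "p < 1"
  shows "summable (\<lambda>n. a ^ n * p powi (int n * (int n - 1)))"
proof -
  have "(\<lambda>n. a * p ^ n) \<longlonglongrightarrow> a * 0"
    using assms by (intro tendsto_intros LIMSEQ_realpow_zero) auto
  hence "eventually (\<lambda>n. a * p ^ n < 1/2) sequentially"
    by (rule order_tendstoD(2)) simp
  then obtain N where N: "\<And>n. n \<ge> N \<Longrightarrow> a * p ^ n < 1/2"
    by (auto simp: eventually_sequentially)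
  have "norm (a ^ n * p powi (int n * (int n - 1))) \<le> (1/2) ^ n" if ge: "n \<ge> Suc N" for n
  proof -
    obtain m where n: "n = Suc m" "m \<ge> N" using Suc_le_D[OF ge] ge by auto
    have "a ^ n * p powi (int n * (int n - 1)) = (a * p ^ m) ^ n"
      by (simp add: n power_mult_distrib power_int_def nat_mult_distrib flip: power_mult)
         (simp add: algebra_simps nat_add_distrib nat_mult_distrib flip: power_add power_mult)
    also have "\<dots> \<le> (1/2) ^ n"
      using N[OF n(2)] assms by (intro power_mono) auto
    finally show ?thesis using assms by (simp add: abs_mult)
  qed
  thus ?thesis
    by (rule summable_comparison_test'[where g = "\<lambda>n. (1/2::real) ^ n", rotated])
       (auto intro: summable_geometric)
qed

text \<open>The terms of index -n form the series over the naturals again, with a replaced by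
  \<open>p\<^sup>2 / a\<close>.\<close>

lemma summable_on_theta:
  fixes a p :: real
  assumes "0 < a" "0 < p" "p < 1"
  shows "(\<lambda>k. a powi k * p powi (k * (k - 1))) summable_on UNIV"
proof -
  let ?f = "\<lambda>k. a powi k * p powi (k * (k - 1))"
  have on_nat: "(\<lambda>n. b ^ n * p powi (int n * (int n - 1))) summable_on UNIV" if "b > 0" for b :: real
    using summable_theta_nat[of b p] that assms by (simp add: summable_on_UNIV_nonneg_real_iff)
  have "?f summable_on range int"
    using on_nat[of a] assms by (subst summable_on_reindex) (auto simp: o_def)
  moreover have "?f (- int n) = (p\<^sup>2 / a) ^ n * p powi (int n * (int n - 1))" for n
  proof -
    have "p powi (- int n * (- int n - 1)) = (p\<^sup>2) ^ n * p powi (int n * (int n - 1))"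
    proof -
      have "(p\<^sup>2) ^ n = p powi (2 * int n)"
        by (simp add: power_int_def nat_mult_distrib flip: power_mult)
      moreover have "- int n * (- int n - 1) = 2 * int n + int n * (int n - 1)"
        by (simp add: algebra_simps)
      ultimately show ?thesis
        using assms by (metis power_int_add less_irrefl)
    qed
    moreover have "a powi (- int n) = inverse a ^ n"
      by (simp only: power_int_minus power_int_of_nat power_inverse)
    ultimately show ?thesis by (simp only: divide_inverse power_mult_distrib mult_ac)
  qed
  hence "?f summable_on range (\<lambda>n. - int n)"
    using on_nat[of "p\<^sup>2 / a"] assms by (subst summable_on_reindex) (auto simp: o_def inj_on_def)
  moreover have "range int \<union> range (\<lambda>n. - int n) = UNIV"
    by (auto simp: image_iff) (metis int_cases2)
  ultimately show ?thesis using summable_on_union[of ?f "range int" "range (\<lambda>n. - int n)"] by simp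
qed

section \<open>q-binomial coefficients and the finite triple product\<close>

definition qfact :: "real \<Rightarrow> nat \<Rightarrow> real" where
  "qfact q n = (\<Prod>i<n. 1 - q ^ Suc i)"

text \<open>The Gaussian binomial coefficient. The value 0 for j > n must be set explicitly, since
  \<open>n - j\<close> is truncated; it lets summation ranges be extended by one.\<close>

definition qbinom :: "real \<Rightarrow> nat \<Rightarrow> nat \<Rightarrow> real" where
  "qbinom q n j = (if j \<le> n then qfact q n / (qfact q j * qfact q (n - j)) else 0)"

lemma qfact_0 [simp]: "qfact q 0 = 1"
  and qfact_Suc: "qfact q (Suc n) = qfact q n * (1 - q ^ Suc n)"
  by (simp_all add: qfact_def)

lemma qfact_pos: "0 < q \<Longrightarrow> q < 1 \<Longrightarrow> 0 < qfact q n"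
  unfolding qfact_def by (intro prod_pos) (simp add: power_less_one_iff del: power_Suc)

text \<open>The q-Pascal rule. With A = q^(j+1) and B = q^(n-j) it comes down to 1 - A B = (1 - B) +
  B (1 - A).\<close>

lemma qbinom_Suc_Suc:
  assumes q: "0 < q" "q < 1" and j: "j \<le> n"
  shows "qbinom q (Suc n) (Suc j) = qbinom q n (Suc j) + q ^ (n - j) * qbinom q n j"
proof (cases "j = n")
  case True
  then show ?thesis using qfact_pos[OF q, of n] qfact_pos[OF q, of "Suc n"] by (simp add: qbinom_def)
next
  case False
  then obtain d where n: "n = Suc (j + d)"
    using j by (metis add_Suc_right le_neq_implies_less less_imp_Suc_add)
  have nz: "qfact q m \<noteq> 0" "1 - q ^ Suc m \<noteq> 0" for m
    using qfact_pos[OF q, of m] qfact_pos[OF q, of "Suc m"] by (auto simp: qfact_Suc)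
  define A B where "A = q ^ Suc j" and "B = q ^ Suc d"
  have "q ^ Suc n = A * B"
    by (simp add: n A_def B_def flip: power_add)
  hence Q: "qfact q (Suc n) = qfact q n * (1 - A * B)" "qfact q (Suc j) = qfact q j * (1 - A)"
    "qfact q (Suc d) = qfact q d * (1 - B)" 
    by (simp_all only: qfact_Suc A_def B_def)
  have "n - j = Suc d" "n - Suc j = d" "Suc j \<le> n" by (simp_all add: n)
  hence "qbinom q (Suc n) (Suc j) = qfact q n * (1 - A * B) / (qfact q j * (1 - A) * (qfact q d * (1 - B)))"
    "qbinom q n (Suc j) = qfact q n / (qfact q j * (1 - A) * qfact q d)"
    "q ^ (n - j) * qbinom q n j = B * (qfact q n / (qfact q j * (qfact q d * (1 - B))))"
    using Q by (simp_all add: qbinom_def B_def)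
  moreover have "1 - A \<noteq> 0" "1 - B \<noteq> 0"
    using nz(2) by (auto simp only: A_def B_def)
  moreover have "C * (1 - A * B) / (D * (1 - A) * (E * (1 - B))) 
      = C / (D * (1 - A) * E) + B * (C / (D * (E * (1 - B))))" 
    if "1 - A \<noteq> 0" "1 - B \<noteq> 0" "D \<noteq> 0" "E \<noteq> 0" for C D E :: real
    using that by (simp add: divide_simps) (simp add: algebra_simps)
  ultimately show ?thesis using nz(1) by simp
qed

text \<open>The finite q-binomial theorem with q = p^2: in the induction the q-Pascal rule splits
  the sum into the two products with the terms of the new factor 1 + z q^n.\<close>

lemma Rothe_identity:
  fixes p z :: real
  assumes p: "0 < p" "p < 1"
  shows "(\<Prod>i<n. 1 + z * (p\<^sup>2) ^ i) = (\<Sum>j\<le>n. qbinom (p\<^sup>2) n j * p powi (int j * (int j - 1)) * z ^ j)"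
proof (induction n)
  case 0
  then show ?case by (simp add: qbinom_def)
next
  case (Suc n)
  define q where "q = p\<^sup>2"
  have q: "0 < q" "q < 1" using p by (auto simp: q_def power_less_one_iff)
  define t where "t j = p powi (int j * (int j - 1))" for j
  \<comment> \<open>Both sides express \<open>t (Suc j) = q ^ j * t j\<close>, multiplied by
    q^(n-j).\<close>
  have t: "q ^ n * t j = q ^ (n - j) * t (Suc j)" if "j \<le> n" for j
  proof -
    have q: "q ^ m = p powi (2 * int m)" for m
      by (simp add: q_def power_int_def nat_mult_distrib flip: power_mult)
    show ?thesis using p that
      unfolding t_def q by (subst (1 2) power_int_add[symmetric]) (auto simp: of_nat_diff algebra_simps)
  qed
  have b0: "qbinom q m 0 = 1" for m
    using qfact_pos[OF q, of m] by (simp add: qbinom_def)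
  have "(\<Sum>j\<le>Suc n. qbinom q (Suc n) j * t j * z ^ j)
      = t 0 + (\<Sum>j\<le>n. qbinom q (Suc n) (Suc j) * t (Suc j) * z ^ Suc j)"
    by (subst sum.atMost_Suc_shift) (simp add: b0)
  also have "\<dots> = t 0 + (\<Sum>j\<le>n. qbinom q n (Suc j) * t (Suc j) * z ^ Suc j)
      + (\<Sum>j\<le>n. q ^ n * z * (qbinom q n j * t j * z ^ j))"
  proof -
    have "qbinom q (Suc n) (Suc j) * t (Suc j) * z ^ Suc j
        = qbinom q n (Suc j) * t (Suc j) * z ^ Suc j + q ^ n * z * (qbinom q n j * t j * z ^ j)"
      if "j \<le> n" for j
    proof -
      have "q ^ n * z * (qbinom q n j * t j * z ^ j) = (q ^ n * t j) * (qbinom q n j * z ^ Suc j)"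
        by (simp only: power_Suc mult_ac)
      thus ?thesis
        unfolding qbinom_Suc_Suc[OF q that] t[OF that] by (simp only: ring_distribs mult_ac)
    qed
    thus ?thesis by (simp flip: sum.distrib)
  qed
  also have "t 0 + (\<Sum>j\<le>n. qbinom q n (Suc j) * t (Suc j) * z ^ Suc j) = (\<Sum>j\<le>Suc n. qbinom q n j * t j * z ^ j)"
    by (subst sum.atMost_Suc_shift) (simp add: b0)
  \<comment> \<open>The term for j = n + 1 is 0 by the convention in \<open>qbinom\<close>.\<close>
  also have "\<dots> = (\<Sum>j\<le>n. qbinom q n j * t j * z ^ j)"
    by (simp add: qbinom_def)
  also have "\<dots> + (\<Sum>j\<le>n. q ^ n * z * (qbinom q n j * t j * z ^ j)) = 
     (\<Sum>j\<le>n. qbinom q n j * t j * z ^ j) * (1 + z * q ^ n)"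
    by (simp only: ring_distribs sum_distrib_left[symmetric] mult_1_right) (simp only: mult_ac)
  finally show ?case using Suc by (simp add: q_def t_def)
qed

text \<open>Rothe's identity with 2n factors and z replaced by -z/q^n: the exponents of q then run
  from -n to n - 1. The negative ones yield the second product up to a constant, and centring the
  summation index at n yields the symmetric sum.\<close>

lemma finite_Jacobi_triple_product:
  fixes p z :: real
  assumes p: "0 < p" "p < 1" and z: "z \<noteq> 0"
  defines "q \<equiv> p\<^sup>2"
  shows "(\<Prod>i<n. 1 - z * q ^ i) * (\<Prod>i<n. 1 - q / z * q ^ i) =
    (\<Sum>k=-int n..int n. qbinom q (2 * n) (nat (int n + k)) * ((- z) powi k * p powi (k * (k - 1))))"
proof -
  have q0: "q > 0" using p by (simp add: q_def)
  \<comment> \<open>The constant that appears when -z/q^(i+1) is pulled out of each of the n factors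
    with a negative power of q.\<close>
  define K where "K = (- z) ^ n * p powi (- int n * (int n + 1))"
  have K: "(\<Prod>i<n. - z / q ^ Suc i) = K"
    unfolding K_def
  proof (induction n)
    case (Suc n)
    have "p powi (- int (Suc n) * (int (Suc n) + 1)) = p powi (- int n * (int n + 1)) * p powi (- 2 * int (Suc n))"
      using p by (subst power_int_add[symmetric]) (auto simp: algebra_simps)
    also have "p powi (- 2 * int (Suc n)) = inverse (q ^ Suc n)"
      by (simp only: mult_minus_left power_int_minus power_int_mult power_int_numeral q_def power_int_of_nat)
    finally show ?case using Suc by (simp add: field_simps)
  qed simp
  have K0: "K \<noteq> 0" using z p by (simp add: K_def)
  have "(\<Prod>i<2*n. 1 + (- z / q ^ n) * q ^ i) = (\<Prod>i<n. 1 + (- z / q ^ n) * q ^ i) * (\<Prod>i<n. 1 + (- z / q ^ n) * q ^ (n + i))"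
    using prod.nat_group[of "\<lambda>i. 1 + (- z / q ^ n) * q ^ i" n 2]
     prod.shift_bounds_nat_ivl[of "\<lambda>i. 1 + (- z / q ^ n) * q ^ i" 0 n n]
    by (simp add: lessThan_atLeast0 numeral_2_eq_2 mult.commute add.commute)
  also have "(\<Prod>i<n. 1 + (- z / q ^ n) * q ^ (n + i)) = (\<Prod>i<n. 1 - z * q ^ i)"
    using q0 by (simp add: power_add)
  \<comment> \<open>Reversing the order makes the exponent of q equal to -(i + 1).\<close>
  also have "(\<Prod>i<n. 1 + (- z / q ^ n) * q ^ i) = (\<Prod>i<n. 1 + (- z / q ^ n) * q ^ (n - Suc i))"
    by (rule prod.nat_diff_reindex[symmetric])
  also have "\<dots> = (\<Prod>i<n. (- z / q ^ Suc i) * (1 - q / z * q ^ i))"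
  proof (rule prod.cong[OF refl])
    fix i assume "i \<in> {..<n}"
    hence "q ^ n = q ^ (n - Suc i) * q ^ Suc i" by (simp only: lessThan_iff flip: power_add) simp
    thus "1 + (- z / q ^ n) * q ^ (n - Suc i) = (- z / q ^ Suc i) * (1 - q / z * q ^ i)"
      using z q0 by (simp add: field_simps)
  qed
  also have "\<dots> = K * (\<Prod>i<n. 1 - q / z * q ^ i)"
    by (simp only: prod.distrib K)
  finally have 1: "(\<Prod>i<2*n. 1 + (- z / q ^ n) * q ^ i) = K * ((\<Prod>i<n. 1 - z * q ^ i) * (\<Prod>i<n. 1 - q / z * q ^ i))"
    by (simp add: mult_ac)
  have "(\<Prod>i<2*n. 1 + (- z / q ^ n) * q ^ i) = 
     (\<Sum>j\<le>2*n. qbinom q (2*n) j * p powi (int j * (int j - 1)) * (- z / q ^ n) ^ j)"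
    unfolding q_def by (rule Rothe_identity) (use p in auto)
  also have "\<dots> = (\<Sum>k=-int n..int n. K * (qbinom q (2 * n) (nat (int n + k)) * ((- z) powi k * p powi (k * (k - 1)))))"
  proof (rule sum.reindex_bij_witness[of _ "\<lambda>k. nat (int n + k)" "\<lambda>j. int j - int n"], goal_cases)
    case (5 j)
    have "(- z / q ^ n) ^ j = (- z) powi (int j) * p powi (- 2 * int n * int j)"
    proof -
      have "p powi (2 * int n * int j) = (q ^ n) ^ j"
        by (simp add: q_def power_int_def nat_mult_distrib flip: power_mult)
      thus ?thesis by (simp only: mult_minus_left power_int_minus power_int_of_nat power_divide) (simp only: divide_inverse)
    qed
    moreover have "K = (- z) powi (int n) * p powi (- int n * (int n + 1))"
      by (simp add: K_def)
    moreover have "(- z) powi (int j) = (- z) powi (int n) * (- z) powi (int j - int n)"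
      using z by (subst power_int_add[symmetric]) auto
    \<comment> \<open>With k = j - n the exponents satisfy j(j-1) - 2nj = -n(n+1) + k(k-1).\<close>
    moreover have "p powi (int j * (int j - 1)) * p powi (- 2 * int n * int j) = 
       p powi (- int n * (int n + 1)) * p powi ((int j - int n) * (int j - int n - 1))"
      using p by (subst (1 2) power_int_add[symmetric]) (auto simp: algebra_simps)
    ultimately show ?case by (simp add: mult_ac)
  qed auto
  also have "\<dots> = K * (\<Sum>k=-int n..int n. qbinom q (2 * n) (nat (int n + k)) * ((- z) powi k * p powi (k * (k - 1))))"
    by (rule sum_distrib_left[symmetric])
  finally show ?thesis using 1 K0 by simp
qed

text \<open>Writing the base \<open>q\<close> as \<open>p\<^sup>2\<close> avoids the division in its exponents \<open>k * (k - 1) / 2\<close>.\<close>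

theorem Jacobi_triple_product:
  fixes p z :: real
  assumes p: "0 < p" "p < 1" and z: "z \<noteq> 0"
  shows "((\<lambda>k. (- z) powi k * p powi (k * (k - 1))) has_sum
          (qpoch (p\<^sup>2) (p\<^sup>2) * qpoch z (p\<^sup>2) * qpoch (p\<^sup>2 / z) (p\<^sup>2))) UNIV"
proof -
  define q where "q = p\<^sup>2"
  have q: "0 < q" "q < 1" using p by (auto simp: q_def power_less_one_iff)
  let ?t = "\<lambda>k. (- z) powi k * p powi (k * (k - 1))"
  \<comment> \<open>The coefficient of the k-th theta term in the finite identity times (q;q)_n,
    extended by 0 so that every sum runs over all integers. It tends to 1 for fixed k.\<close>
  define a where "a n k = (if \<bar>k\<bar> \<le> int n then qfact q n * qbinom q (2 * n) (nat (int n + k)) else 0)" for n k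
  have lim_qfact: "qfact q \<longlonglongrightarrow> qpoch q q"
    using qpoch_LIMSEQ[of q q] q by (simp add: qfact_def[abs_def])
  have pos: "qpoch q q > 0" by (rule qpoch_pos) (use q in auto)
  \<comment> \<open>Since (q;q)_n decreases from 1 to its positive limit, the coefficients are
    bounded uniformly in n and k, as domination requires.\<close>
  have dec: "decseq (qfact q)"
    using qfact_pos[OF q] q by (intro decseq_SucI) (auto simp: qfact_Suc intro!: mult_left_le)
  have ge: "qpoch q q \<le> qfact q n" for n
    using decseq_ge[OF dec lim_qfact] .
  have le: "qfact q n \<le> 1" for n
    using decseqD[OF dec, of 0 n] by simp
  have a_eq: "a n k = qfact q n * (qfact q (2 * n) / (qfact q (nat (int n + k)) * qfact q (nat (int n - k))))"
    if "\<bar>k\<bar> \<le> int n" for n k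
  proof -
    have "2 * n - nat (int n + k) = nat (int n - k)" "nat (int n + k) \<le> 2 * n" using that by auto
    thus ?thesis using that by (simp add: a_def qbinom_def)
  qed
  have lim_a: "(\<lambda>n. a n k) \<longlonglongrightarrow> 1" for k
  proof -
    have "filterlim (\<lambda>n. nat (int n + c)) at_top sequentially" for c
      unfolding filterlim_at_top
    proof
      fix Z show "\<forall>\<^sub>F n in sequentially. Z \<le> nat (int n + c)"
        using eventually_ge_at_top[of "nat (int Z + \<bar>c\<bar>)"] by eventually_elim auto
    qed
    note shift = filterlim_compose[OF lim_qfact this]
    have "filterlim (\<lambda>n. 2 * n) at_top (sequentially :: nat filter)"
      by (intro filterlim_subseq) (auto simp: strict_mono_def)
    note double = filterlim_compose[OF lim_qfact this]
    have "(\<lambda>n. qfact q n * (qfact q (2 * n) / (qfact q (nat (int n + k)) * qfact q (nat (int n - k)))))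
       \<longlonglongrightarrow> qpoch q q * (qpoch q q / (qpoch q q * qpoch q q))"
      using pos shift[of k] shift[of "-k"] by (intro tendsto_intros lim_qfact double) auto
    moreover have "\<forall>\<^sub>F n in sequentially. qfact q n * (qfact q (2 * n) / (qfact q (nat (int n + k)) * qfact q (nat (int n - k)))) = a n k"
      using eventually_ge_at_top[of "nat \<bar>k\<bar>"] by eventually_elim (simp add: a_eq)
    ultimately show ?thesis using pos by (simp add: tendsto_cong)
  qed
  have bound_a: "\<bar>a n k\<bar> \<le> 1 / (qpoch q q)\<^sup>2" for n k
  proof (cases "\<bar>k\<bar> \<le> int n")
    case True
    have "a n k \<le> 1 * (1 / (qpoch q q * qpoch q q))"
      unfolding a_eq[OF True]
      by (intro mult_mono frac_le ge le) (use pos qfact_pos[OF q] in \<open>auto intro: less_imp_le\<close>)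
    moreover have "a n k \<ge> 0" unfolding a_eq[OF True]
      using qfact_pos[OF q] by (auto intro!: mult_nonneg_nonneg divide_nonneg_nonneg less_imp_le)
    ultimately show ?thesis by (simp add: power2_eq_square)
  qed (use pos in \<open>simp add: a_def\<close>)
  have sm_bound: "(\<lambda>k. 1 / (qpoch q q)\<^sup>2 * (\<bar>z\<bar> powi k * p powi (k * (k - 1)))) summable_on UNIV"
    using summable_on_theta[of "\<bar>z\<bar>" p] z p by (intro summable_on_cmult_right) auto
  have bound: "\<bar>a n k * ?t k\<bar> \<le> 1 / (qpoch q q)\<^sup>2 * (\<bar>z\<bar> powi k * p powi (k * (k - 1)))" for n k
    unfolding abs_mult using bound_a[of n k] p by (intro mult_mono) (auto simp: power_int_abs)
  have lim: "(\<lambda>n. a n k * ?t k) \<longlonglongrightarrow> ?t k" for k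
    using tendsto_mult_right[OF lim_a[of k], of "?t k"] by simp
  note sm = tendsto_infsum_dominated(1)[OF lim bound sm_bound]
    and lim1 = tendsto_infsum_dominated(2)[OF lim bound sm_bound]
  have "(\<Sum>\<^sub>\<infinity>k. a n k * ?t k) = qfact q n * ((\<Prod>i<n. 1 - z * q ^ i) * (\<Prod>i<n. 1 - q / z * q ^ i))" for n
  proof -
    have "((\<lambda>k. a n k * ?t k) has_sum (\<Sum>k=-int n..int n. a n k * ?t k)) UNIV"
      by (rule has_sum_finite_neutralI) (auto simp: a_def)
    hence "(\<Sum>\<^sub>\<infinity>k. a n k * ?t k) = (\<Sum>k=-int n..int n. a n k * ?t k)"
      by (rule infsumI)
    also have "\<dots> = (\<Sum>k=-int n..int n. qfact q n * (qbinom q (2 * n) (nat (int n + k)) * ?t k))"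
      by (intro sum.cong) (auto simp: a_def)
    also have "\<dots> = qfact q n * ((\<Prod>i<n. 1 - z * q ^ i) * (\<Prod>i<n. 1 - q / z * q ^ i))"
      using finite_Jacobi_triple_product[OF p z, of n] by (simp add: q_def sum_distrib_left)
    finally show ?thesis .
  qed
  hence "(\<lambda>n. \<Sum>\<^sub>\<infinity>k. a n k * ?t k) \<longlonglongrightarrow> qpoch q q * (qpoch z q * qpoch (q / z) q)"
    using q by (simp only:) (intro tendsto_intros lim_qfact qpoch_LIMSEQ; simp)
  hence "infsum ?t UNIV = qpoch q q * (qpoch z q * qpoch (q / z) q)"
    using lim1 LIMSEQ_unique by blast
  thus ?thesis using sm by (simp add: q_def mult.assoc summable_iff_has_sum_infsum)
qed

section \<open>The quintuple product\<close>

lemma qpoch_split_3: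
  assumes "0 \<le> q" "q < 1"
  shows "qpoch a q = qpoch a (q ^ 3) * qpoch (a * q) (q ^ 3) * qpoch (a * q\<^sup>2) (q ^ 3)"
  using qpoch_split[OF assms, of 3 a] by (simp add: numeral_3_eq_3 lessThan_Suc power2_eq_square mult_ac)

text \<open>
  Carlitz and Subbarao: multiply the two triple products with summation indices \<open>i\<close> and \<open>j\<close> and
  group by \<open>i + 2 * j = 3 * m + r\<close>. With \<open>j = m + k\<close> every class splits into a series in \<open>m\<close> times a
  series in \<open>k\<close> free of \<open>z\<close>; the latter equals \<open>qpoch (q\<^sup>2) (q\<^sup>2)\<close> for \<open>r = 0, 1\<close> and
  vanishes for \<open>r = 2\<close>.
\<close>

theorem quintuple_product:
  fixes p z :: real
  assumes p: "0 < p" "p < 1" and z: "z \<noteq> 0"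
  defines "q \<equiv> p\<^sup>2"
  shows "((\<lambda>m. p powi (m * (3 * m - 1)) * z powi (3 * m) - p powi (m * (3 * m + 1)) * z powi (3 * m + 1)) has_sum
          (qpoch q q * qpoch z q * qpoch (q / z) q * qpoch (q * z\<^sup>2) (q\<^sup>2) * qpoch (q / z\<^sup>2) (q\<^sup>2))) UNIV"
proof -
  \<comment> \<open>Signed monomials reduce each identity between terms to equal exponents of p and
    z and equal parity of the sign exponent.\<close>
  define mon where "mon a b s = (-1) powi s * p powi a * z powi b" for a b s
  have mult: "mon a b s * mon a' b' s' = mon (a + a') (b + b') (s + s')" for a b s a' b' s'
    using p z by (simp add: mon_def power_int_add)
  have eqI: "mon a b s = mon a' b' s'" if "a = a'" "b = b'" "even (s - s')" for a b s a' b' s'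
    using that by (auto simp: mon_def power_int_minus_left)
  have pw: "p powi e = mon e 0 0" and zpw: "z powi e = mon 0 e 0"
    and nzpw: "(- (p ^ a * z ^ b)) powi e = mon (int a * e) (int b * e) e"
    and zpw': "(p ^ a * z ^ b) powi e = mon (int a * e) (int b * e) 0"
    and ppw: "(p ^ a) powi e = mon (int a * e) 0 0" 
    and nppw: "(- (p ^ a)) powi e = mon (int a * e) 0 e" for a b e
    by (simp_all add: mon_def power_int_minus_left power_int_mult_distrib power_int_power)
  have nz: "(- z) powi e = mon 0 e e" for e using nzpw[of 0 1 e] by simp
  note mons = nz nzpw zpw' ppw nppw pw zpw mult
  have p_pow: "0 < p ^ c" "p ^ c < 1" if "c > 0" for c
    using p that by (auto simp: power_less_one_iff)
  \<comment> \<open>The theta series with base q and argument z, and with base q^2 and argument q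
    z^2.\<close>
  define F where "F i = (- z) powi i * p powi (i * (i - 1))" for i
  define G where "G j = (- (p\<^sup>2 * z\<^sup>2)) powi j * (p\<^sup>2) powi (j * (j - 1))" for j
  define s where "s = qpoch q q * qpoch z q * qpoch (q / z) q"
  define t where "t = qpoch (q * z\<^sup>2) (q\<^sup>2) * qpoch (q / z\<^sup>2) (q\<^sup>2)"
  define e where "e = qpoch (q\<^sup>2) (q\<^sup>2)"
  have q: "0 < q" "q < 1" "0 < q\<^sup>2" "q\<^sup>2 < 1" using p_pow[of 2] p_pow[of 4] by (auto simp: q_def)
  have e_pos: "e > 0" using q unfolding e_def by (intro qpoch_pos) auto
  have F: "(F has_sum s) UNIV"
    using Jacobi_triple_product[OF p z] by (simp add: F_def[abs_def] s_def q_def)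
  have "q\<^sup>2 / (q * z\<^sup>2) = q / z\<^sup>2" using q z by (simp add: power2_eq_square)
  hence G: "(G has_sum (e * t)) UNIV"
    using Jacobi_triple_product[of "p\<^sup>2" "p\<^sup>2 * z\<^sup>2"] p_pow[of 2] z p
    by (simp add: G_def[abs_def] e_def t_def q_def mult_ac)
  have FG: "((\<lambda>(i, j). F i * G j) has_sum (s * (e * t))) UNIV"
    using has_sum_prod_real[OF F G] by simp
  \<comment> \<open>The z-free series: base p^12 and argument p^8, p^4 or 1 for r = 0, 1, 2.
    Splitting (p^4; p^4) modulo 3 gives its value for r = 0 and 1, while argument 1 gives 0.\<close>
  define V where "V r k = (- (p ^ (8 - 4 * r))) powi k * (p ^ 6) powi (k * (k - 1))" for r :: nat and k :: int
  have e_split: "qpoch (p ^ 4) (p ^ 4) = qpoch (p ^ 12) (p ^ 12) * qpoch (p ^ 8) (p ^ 12) * qpoch (p ^ 4) (p ^ 12)"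
    using qpoch_split_3[of "p ^ 4" "p ^ 4"] p_pow[of 4] by (simp flip: power_mult power_add)
  have ratio: "p ^ 12 / p ^ 8 = p ^ 4" "p ^ 12 / p ^ 4 = p ^ 8"
    using p by (simp_all flip: power_diff)
  have V: "(V 0 has_sum e) UNIV" "(V 1 has_sum e) UNIV" "(V 2 has_sum 0) UNIV"
    using Jacobi_triple_product[of "p ^ 6" "p ^ 8"] Jacobi_triple_product[of "p ^ 6" "p ^ 4"]
      Jacobi_triple_product[of "p ^ 6" 1] p_pow[of 6] p_pow[of 12] p qpoch_1[of "p ^ 12"]
    by (simp_all add: V_def[abs_def] e_def q_def e_split ratio mult_ac flip: power_mult)
  define u where "u r m = mon (m * (3 * m - 1) + 2 * int r * m + int r * (int r - 1)) (3 * m + int r) (int r)" for r :: nat and m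
  have summable_u: "u r summable_on UNIV" for r
  proof -
    \<comment> \<open>A theta series with base p^6 and a negated argument, hence the double minus;
      the triple product is invoked here for convergence only.\<close>
    have "u r m = mon (int r * (int r - 1)) (int r) (int r) *
        ((- (- (p ^ (2 + 2 * r) * z ^ 3))) powi m * (p ^ 3) powi (m * (m - 1)))" for m
      unfolding u_def minus_minus mons by (rule eqI) (auto simp: algebra_simps)
    hence "u r = (\<lambda>m. mon (int r * (int r - 1)) (int r) (int r) *
        ((- (- (p ^ (2 + 2 * r) * z ^ 3))) powi m * (p ^ 3) powi (m * (m - 1))))"
      by blast
    moreover have "- (p ^ (2 + 2 * r) * z ^ 3) \<noteq> 0" using p z by simp
    ultimately show ?thesis
      using p_pow[of 3]
      by (simp only:) (rule summable_on_cmult_right, rule has_sum_imp_summable, rule Jacobi_triple_product, auto)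
  qed
  define a where "a r = infsum (u r) UNIV" for r
  have u: "(u r has_sum a r) UNIV" for r
    using summable_u by (simp add: a_def summable_iff_has_sum_infsum)
  have part: "((\<lambda>(i, j). F i * G j) has_sum (a r * v)) {(i, j). (i + 2 * j) mod 3 = int r}"
    if r: "r \<le> 2" and v: "(V r has_sum v) UNIV" for r v
  proof -
    have "((\<lambda>(m, k). u r m * V r k) has_sum (a r * v)) (UNIV \<times> UNIV)"
      by (rule has_sum_prod_real[OF u v])
    also have "?this \<longleftrightarrow> ?thesis"
    \<comment> \<open>Solving i + 2j = 3m + r and j = m + k for i gives i = m + r - 2k.\<close>
    proof (rule has_sum_reindex_bij_witness[where j = "\<lambda>(m, k). (m + int r - 2 * k, m + k)"
          and i = "\<lambda>(i, j). ((i + 2 * j) div 3, j - (i + 2 * j) div 3)"], goal_cases)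
      case (5 mk)
      obtain m k where mk: "mk = (m, k)" by force
      have exponent: "int (8 - 4 * r) = 8 - 4 * int r" using r by simp
      have "F (m + int r - 2 * k) * G (m + k) = u r m * V r k"
        unfolding F_def G_def u_def V_def mons exponent
        by (rule eqI) (auto simp: algebra_simps power2_eq_square)
      thus ?case by (simp add: mk)
    qed (use r in \<open>auto simp: algebra_simps\<close>; presburger)+
    finally show ?thesis .
  qed
  have "((\<lambda>(i, j). F i * G j) has_sum (a 0 * e + a 1 * e + a 2 * 0))
     ({(i, j). (i + 2 * j) mod 3 = int 0} \<union> {(i, j). (i + 2 * j) mod 3 = int 1} \<union> {(i, j). (i + 2 * j) mod 3 = int 2})"
    by (intro has_sum_Un_disjoint part V) auto
  also have "({(i, j). (i + 2 * j) mod 3 = int 0} \<union> {(i, j). (i + 2 * j) mod 3 = int 1} \<union> {(i, j). (i + 2 * j) mod 3 = int 2}) = UNIV"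
    by auto
  finally have "s * (e * t) = a 0 * e + a 1 * e"
    using FG has_sum_unique by force
  hence "(s * t) * e = (a 0 + a 1) * e" by (simp add: algebra_simps)
  hence st: "s * t = a 0 + a 1" using e_pos by simp
  have "((\<lambda>m. u 0 m + u 1 m) has_sum (a 0 + a 1)) UNIV"
    by (intro has_sum_add u)
  moreover have "u 0 m + u 1 m = p powi (m * (3 * m - 1)) * z powi (3 * m) - p powi (m * (3 * m + 1)) * z powi (3 * m + 1)" for m
    by (simp add: u_def mon_def algebra_simps)
  ultimately show ?thesis
    unfolding st[symmetric] s_def t_def by (simp only: mult_ac)
qed

section \<open>Theta series identities\<close>

lemma has_sum_diff:
  fixes f g :: "'a \<Rightarrow> real"
  assumes "(f has_sum a) A" "(g has_sum b) A"
  shows "((\<lambda>x. f x - g x) has_sum (a - b)) A"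
  using has_sum_add[OF assms(1) has_sum_uminusI[OF assms(2)]] by simp

lemma has_sum_int_even_odd:
  fixes f :: "int \<Rightarrow> real"
  assumes "((\<lambda>n. f (2 * n)) has_sum a) UNIV" "((\<lambda>n. f (2 * n + 1)) has_sum b) UNIV"
  shows "(f has_sum (a + b)) UNIV"
proof -
  have "(f has_sum a) {n. even n}" 
    using assms(1) by (subst (asm) has_sum_reindex_bij_witness[of UNIV "\<lambda>n. n div 2" "\<lambda>n. 2 * n" "{n. even n}" f]) auto
  moreover have "(f has_sum b) {n. odd n}" 
    using assms(2) by (subst (asm) has_sum_reindex_bij_witness[of UNIV "\<lambda>n. n div 2" "\<lambda>n. 2 * n + 1" "{n. odd n}" f]) auto
  ultimately have "(f has_sum (a + b)) ({n. even n} \<union> {n. odd n})"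
    by (rule has_sum_Un_disjoint) auto
  moreover have "{n. even n} \<union> {n. odd n} = (UNIV :: int set)" by auto
  ultimately show ?thesis by simp
qed

text \<open>Writing a k^2 + b k + c as c + (a + b) k + a k(k-1) exhibits a multiple of a theta
  series.\<close>

lemma summable_on_powi_quadratic:
  fixes x :: real and b c :: int
  assumes x: "0 < x" "x < 1" and a: "0 < a"
  shows "(\<lambda>k. x powi (int a * k\<^sup>2 + b * k + c)) summable_on UNIV"
proof -
  have "x powi (int a * k\<^sup>2 + b * k + c) = x powi c * ((x powi (int a + b)) powi k * (x ^ a) powi (k * (k - 1)))" for k
  proof -
    have "int a * k\<^sup>2 + b * k + c = c + ((int a + b) * k + int a * (k * (k - 1)))"
      by (simp add: algebra_simps power2_eq_square)
    thus ?thesis using x by (simp add: power_int_add power_int_mult)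
  qed
  moreover have "x ^ a < 1" using x a by (simp add: power_less_one_iff)
  ultimately show ?thesis
    using x by (auto intro!: summable_on_cmult_right summable_on_theta)
qed

lemma has_sum_int_reflect:
  fixes f :: "int \<Rightarrow> real" and c :: int
  shows "((\<lambda>n. f (c - n)) has_sum a) UNIV \<longleftrightarrow> (f has_sum a) UNIV"
  by (rule has_sum_reindex_bij_witness[of _ "\<lambda>n. c - n" "\<lambda>n. c - n"]) auto

text \<open>The quintuple product writes P as S(-6,0) - S(18,2) and x^2 Q as S(18,2) - S(42,12),
  where S(b,c) is the sum of x^(36k^2+bk+c) over all integers k. In the sum S(18,2) cancels, in the
  difference it doubles; splitting the remaining two series by the parity of the index produces the
  same combinations.\<close>

lemma theta_identities:
  fixes x :: real
  assumes x: "0 < x" "x < 1"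
  defines "P \<equiv> qpoch (x^24) (x^24) * qpoch (x\<^sup>2) (x^24) * qpoch (x^22) (x^24) * qpoch (x^28) (x^48) * qpoch (x^20) (x^48)"
  defines "Q \<equiv> qpoch (x^24) (x^24) * qpoch (x^10) (x^24) * qpoch (x^14) (x^24) * qpoch (x^44) (x^48) * qpoch (x^4) (x^48)"
  defines "R \<equiv> qpoch (x^6) (x^6) * qpoch (x\<^sup>2) (x^6) * qpoch (x^4) (x^6) * qpoch (x^10) (x^12) * qpoch (x\<^sup>2) (x^12)"
  shows "P + x\<^sup>2 * Q = qpoch (x^6) (x^6)" and "P - x\<^sup>2 * Q = R"
proof -
  have xp: "0 < x ^ c" "x ^ c < 1" if "c > 0" for c
    using x that by (auto simp: power_less_one_iff)
  have div: "x ^ a / x ^ b = x ^ (a - b)" if "b \<le> a" for a b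
    using x that by (simp add: power_diff)
  have pw: "(x ^ a) powi e = x powi (int a * e)" for a e by (rule power_int_power)
  have add: "x powi a * x powi b = x powi (a + b)" for a b
    using x by (simp add: power_int_add)
  define f where "f b c k = x powi (36 * k\<^sup>2 + b * k + c)" for b c k :: int
  define S where "S b c = infsum (f b c) UNIV" for b c
  have S: "(f b c has_sum S b c) UNIV" for b c
    using summable_on_powi_quadratic[OF x, of 36 b c]
    by (simp add: S_def f_def[abs_def] summable_iff_has_sum_infsum)
  have "(\<lambda>m. (x^12) powi (m * (3 * m - 1)) * (x\<^sup>2) powi (3 * m) - (x^12) powi (m * (3 * m + 1)) * (x\<^sup>2) powi (3 * m + 1))
     = (\<lambda>m. f (-6) 0 m - f 18 2 m)"
    unfolding pw add f_def by (simp add: algebra_simps power2_eq_square)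
  with quintuple_product[of "x^12" "x\<^sup>2"] have P: "((\<lambda>m. f (-6) 0 m - f 18 2 m) has_sum P) UNIV"
    using xp[of 12] xp[of 2] by (simp add: P_def div flip: power_mult power_add)
  hence P: "P = S (-6) 0 - S 18 2"
    using has_sum_diff[OF S S] has_sum_unique by blast
  have "(\<lambda>m. (x^12) powi (m * (3 * m - 1)) * (x^10) powi (3 * m) - (x^12) powi (m * (3 * m + 1)) * (x^10) powi (3 * m + 1))
     = (\<lambda>m. f 18 0 m - f 42 10 m)"
    unfolding pw add f_def by (simp add: algebra_simps power2_eq_square)
  with quintuple_product[of "x^12" "x^10"] have "((\<lambda>m. f 18 0 m - f 42 10 m) has_sum Q) UNIV"
    using xp[of 12] xp[of 10] by (simp add: Q_def div flip: power_mult power_add)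
  hence "((\<lambda>m. x\<^sup>2 * (f 18 0 m - f 42 10 m)) has_sum (x\<^sup>2 * Q)) UNIV"
    by (rule has_sum_cmult_right)
  moreover have "(\<lambda>m. x\<^sup>2 * (f 18 0 m - f 42 10 m)) = (\<lambda>m. f 18 2 m - f 42 12 m)"
    using add[of 2] by (simp add: f_def right_diff_distrib add_ac)
  ultimately have Q: "x\<^sup>2 * Q = S 18 2 - S 42 12"
    using has_sum_diff[OF S S] has_sum_unique by metis
  \<comment> \<open>The halves of the series split below appear with other linear terms; the
    substitutions k to -k and k to -1-k turn them into the series \<open>S\<close> above.\<close>
  have refl1: "((\<lambda>n. f 6 0 n) has_sum (S (-6) 0)) UNIV"
    using S[of "-6" 0] by (subst (asm) has_sum_int_reflect[of _ 0, symmetric]) (simp add: f_def)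
  have refl2: "((\<lambda>n. f 30 6 n) has_sum (S 42 12)) UNIV"
    using S[of 42 12] by (subst (asm) has_sum_int_reflect[of _ "-1", symmetric])
       (simp add: f_def algebra_simps power2_eq_square)
  have refl3: "((\<lambda>n. f 54 20 n) has_sum (S 18 2)) UNIV"
    using S[of 18 2] by (subst (asm) has_sum_int_reflect[of _ "-1", symmetric])
       (simp add: f_def algebra_simps power2_eq_square)
  define g where "g b c k = x powi (9 * k\<^sup>2 + b * k + c)" for b c k :: int
  \<comment> \<open>Euler's pentagonal series in x^6, since 9k^2 - 3k is six times k(3k-1)/2. Odd
    indices carry the minus sign.\<close>
  have "((\<lambda>k. (-1) powi k * g (-3) 0 k) has_sum (S (-6) 0 + - S 42 12)) UNIV"
  proof (rule has_sum_int_even_odd)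
    show "((\<lambda>n. (- 1) powi (2 * n) * g (- 3) 0 (2 * n)) has_sum S (- 6) 0) UNIV"
      using S[of "-6" 0] by (simp add: f_def[abs_def] g_def algebra_simps power2_eq_square)
    show "((\<lambda>n. (- 1) powi (2 * n + 1) * g (- 3) 0 (2 * n + 1)) has_sum - S 42 12) UNIV"
      using has_sum_uminusI[OF refl2] by (simp add: f_def[abs_def] g_def algebra_simps power2_eq_square)
  qed
  moreover have "(\<lambda>k. (-1) powi k * g (-3) 0 k) = (\<lambda>k. (- (x ^ 6)) powi k * (x ^ 9) powi (k * (k - 1)))"
  proof
    fix k
    have "(- (x ^ 6)) powi k = (-1) powi k * (x ^ 6) powi k"
      using power_int_mult_distrib[of "-1" "x ^ 6" k] by simp
    thus "(-1) powi k * g (-3) 0 k = (- (x ^ 6)) powi k * (x ^ 9) powi (k * (k - 1))"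
      unfolding pw by (simp add: mult.assoc add g_def) (simp add: algebra_simps power2_eq_square)
  qed
  moreover have "qpoch (x^6) (x^6) = qpoch (x ^ 18) (x ^ 18) * qpoch (x ^ 6) (x ^ 18) * qpoch (x ^ 12) (x ^ 18)"
    using qpoch_split_3[of "x^6" "x^6"] xp[of 6] by (simp flip: power_mult power_add)
  ultimately have "qpoch (x^6) (x^6) = S (-6) 0 - S 42 12"
    using Jacobi_triple_product[of "x^9" "x^6"] xp[of 9] xp[of 6] has_sum_unique
    by (fastforce simp: div simp flip: power_mult)
  thus "P + x\<^sup>2 * Q = qpoch (x^6) (x^6)" using P Q by simp
  have "(g 3 0 has_sum (S (-6) 0 + S 42 12)) UNIV"
    using refl1 S[of 42 12]
    by (intro has_sum_int_even_odd) (simp_all add: f_def[abs_def] g_def algebra_simps power2_eq_square)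
  \<comment> \<open>Both halves have the same sum, which accounts for the coefficient 2 of
    \<open>S 18 2\<close>.\<close>
  moreover have "(g 9 2 has_sum (S 18 2 + S 18 2)) UNIV"
    using refl3 S[of 18 2]
    by (intro has_sum_int_even_odd) (simp_all add: f_def[abs_def] g_def algebra_simps power2_eq_square)
  ultimately have "((\<lambda>m. g 3 0 m - g 9 2 m) has_sum (S (-6) 0 + S 42 12 - (S 18 2 + S 18 2))) UNIV"
    by (rule has_sum_diff)
  moreover have "(\<lambda>m. (x^3) powi (m * (3 * m - 1)) * (x\<^sup>2) powi (3 * m) - (x^3) powi (m * (3 * m + 1)) * (x\<^sup>2) powi (3 * m + 1))
     = (\<lambda>m. g 3 0 m - g 9 2 m)"
    unfolding pw add g_def by (simp add: algebra_simps power2_eq_square)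
  with quintuple_product[of "x^3" "x\<^sup>2"] have "((\<lambda>m. g 3 0 m - g 9 2 m) has_sum R) UNIV"
    using xp[of 3] xp[of 2] by (simp add: R_def div flip: power_mult power_add)
  ultimately show "P - x\<^sup>2 * Q = R" using P Q has_sum_unique by fastforce
qed

section \<open>Generating functions of weighted partitions\<close>

text \<open>A multiset over \<open>insert a A\<close> is a multiplicity of a together with a
  multiset over A, so each element contributes one geometric series.\<close>

lemma has_sum_multisets_finite:
  fixes w :: "'a \<Rightarrow> real"
  assumes "finite A" "\<And>k. k \<in> A \<Longrightarrow> \<bar>w k\<bar> < 1"
  shows "((\<lambda>p. \<Prod>k\<in>#p. w k) has_sum (\<Prod>k\<in>A. inverse (1 - w k))) {p. set_mset p \<subseteq> A}"
  using assms
proof (induction A rule: finite_induct)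
  case empty
  then show ?case by (auto intro: has_sum_finiteI)
next
  case (insert a A)
  have "((\<lambda>j. w a ^ j) has_sum (1 / (1 - w a))) UNIV"
    using insert.prems[of a] geometric_sums[of "w a"]
    by (intro norm_summable_imp_has_sum) (auto simp: power_abs intro!: summable_geometric)
  hence "((\<lambda>(j, p). w a ^ j * (\<Prod>k\<in>#p. w k)) has_sum 
      (1 / (1 - w a) * (\<Prod>k\<in>A. inverse (1 - w k)))) (UNIV \<times> {p. set_mset p \<subseteq> A})"
    using insert by (intro has_sum_prod_real) auto
  also have "?this \<longleftrightarrow> ((\<lambda>p. \<Prod>k\<in>#p. w k) has_sum (\<Prod>k\<in>insert a A. inverse (1 - w k))) {p. set_mset p \<subseteq> insert a A}"
  proof (rule has_sum_reindex_bij_witness[where j = "\<lambda>(j, p). p + replicate_mset j a"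
          and i = "\<lambda>p. (count p a, filter_mset (\<lambda>x. x \<noteq> a) p)"], goal_cases)
    case (1 jp)
    then obtain j q where jq: "jp = (j, q)" "a \<notin># q" using insert.hyps by auto
    then have "filter_mset (\<lambda>x. x \<noteq> a) q = q" "filter_mset (\<lambda>x. x \<noteq> a) (replicate_mset j a) = {#}"
      by (auto simp: filter_mset_eq_conv)
    then show ?case using jq by (simp add: not_in_iff)
  next
    case (2 jp)
    then show ?case by (auto simp: subset_iff split: if_splits)
  next
    case (3 p)
    then show ?case by (auto intro!: multiset_eqI)
  next
    case (4 p)
    then show ?case by auto
  next
    case (5 jp)
    then show ?case by (auto simp: prod_mset_replicate_mset)
  next
    case 6
    then show ?case using insert.hyps by (simp add: field_simps)
  qed
  finally show ?case .
qed

text \<open>Dominated convergence along the multisets over \<open>{..<N}\<close>. The absolute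
  values dominate; their finite sums are bounded by the product formed with
  \<open>\<bar>w k\<bar>\<close>.\<close>

lemma has_sum_multisets:
  fixes w :: "nat \<Rightarrow> real"
  assumes w: "\<And>k. \<bar>w k\<bar> < 1" and sm: "summable (\<lambda>k. \<bar>w k\<bar>)"
  shows "((\<lambda>p. \<Prod>k\<in>#p. w k) has_sum (inverse (\<Prod>k. 1 - w k))) UNIV"
proof -
  let ?W = "\<lambda>p. \<Prod>k\<in>#p. w k" and ?M = "\<lambda>N::nat. {p. set_mset p \<subseteq> {..<N}}"
  have conv: "convergent_prod (\<lambda>k. 1 - u k)" if "summable (\<lambda>k. \<bar>u k\<bar>)" for u :: "nat \<Rightarrow> real"
    using that by (intro abs_convergent_prod_imp_convergent_prod summable_imp_abs_convergent_prod) simp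
  have lim: "(\<lambda>n. \<Prod>k<n. 1 - u k) \<longlonglongrightarrow> (\<Prod>k. 1 - u k)" if "summable (\<lambda>k. \<bar>u k\<bar>)" for u :: "nat \<Rightarrow> real"
    using convergent_prod_LIMSEQ[OF conv[OF that]] by (simp add: LIMSEQ_lessThan_iff_atMost)
  have pos: "(\<Prod>k. 1 - u k) > 0" if "summable (\<lambda>k. \<bar>u k\<bar>)" "\<And>k. \<bar>u k\<bar> < 1" for u :: "nat \<Rightarrow> real"
    using that(2) by (intro less_0_prodinf conv that(1)) (smt (verit))
  have in_M: "\<exists>N0. \<forall>N\<ge>N0. p \<in> ?M N" for p :: "nat multiset"
  proof (intro exI allI impI)
    \<comment> \<open>For the empty multiset \<open>Max\<close> is unspecified, but then there is no
      element to bound.\<close>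
    fix N assume N: "Suc (Max (set_mset p)) \<le> N"
    have "k < N" if "k \<in># p" for k
      using Max_ge[OF finite_set_mset that] N by linarith
    thus "p \<in> ?M N" by auto
  qed
  define B where "B = inverse (\<Prod>k. 1 - \<bar>w k\<bar>)"
  have abs_W: "\<bar>?W p\<bar> = (\<Prod>k\<in>#p. \<bar>w k\<bar>)" for p
    by (induction p) (auto simp: abs_mult)
  have le_B: "(\<Prod>k<N. inverse (1 - \<bar>w k\<bar>)) \<le> B" for N
  proof -
    have "decseq (\<lambda>n. \<Prod>k<n. 1 - \<bar>w k\<bar>)"
    proof (rule decseq_SucI)
      fix n
      have "(\<Prod>k<n. 1 - \<bar>w k\<bar>) \<ge> 0" using w by (intro prod_nonneg) (auto intro: less_imp_le)
      from mult_left_le[OF _ this, of "1 - \<bar>w n\<bar>"]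
      show "(\<Prod>k<Suc n. 1 - \<bar>w k\<bar>) \<le> (\<Prod>k<n. 1 - \<bar>w k\<bar>)" by simp
    qed
    hence "(\<Prod>k. 1 - \<bar>w k\<bar>) \<le> (\<Prod>k<N. 1 - \<bar>w k\<bar>)"
      using lim[of "\<lambda>k. \<bar>w k\<bar>"] sm decseq_ge by simp
    thus ?thesis
      using pos[of "\<lambda>k. \<bar>w k\<bar>"] sm w prod_inversef[of "\<lambda>k. 1 - \<bar>w k\<bar>" "{..<N}"]
      by (simp add: B_def le_imp_inverse_le o_def)
  qed
  have sm_W: "(\<lambda>p. \<bar>?W p\<bar>) summable_on UNIV"
  proof (rule nonneg_bdd_above_summable_on)
    show "bdd_above (sum (\<lambda>p. \<bar>?W p\<bar>) ` {F. F \<subseteq> UNIV \<and> finite F})"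
    proof (rule bdd_aboveI2)
      fix F :: "nat multiset set" assume "F \<in> {F. F \<subseteq> UNIV \<and> finite F}"
      hence F: "finite F" by simp
      obtain N where N: "F \<subseteq> ?M N"
      proof -
        have "\<forall>p. \<exists>N0. \<forall>N\<ge>N0. p \<in> ?M N" by (rule allI[OF in_M])
        then obtain n where n: "\<And>p N. N \<ge> n p \<Longrightarrow> p \<in> ?M N" by metis
        have "F \<subseteq> ?M (Max (n ` F))" using F by (intro subsetI n) auto
        thus ?thesis using that by blast
      qed
      have "(\<Sum>p\<in>F. \<bar>?W p\<bar>) \<le> (\<Prod>k<N. inverse (1 - \<bar>w k\<bar>))"
        unfolding abs_W
        by (rule finite_sum_le_has_sum[OF has_sum_multisets_finite F N]) (use w in \<open>auto simp flip: abs_W\<close>)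
      thus "(\<Sum>p\<in>F. \<bar>?W p\<bar>) \<le> B" using le_B[of N] by linarith
    qed
  qed simp
  define f where "f N p = (if p \<in> ?M N then ?W p else 0)" for N p
  have lim_f: "(\<lambda>N. f N p) \<longlonglongrightarrow> ?W p" for p
  proof -
    obtain N0 where "\<forall>N\<ge>N0. p \<in> ?M N" using in_M[of p] by blast
    hence "eventually (\<lambda>N. f N p = ?W p) sequentially"
      unfolding eventually_sequentially f_def by (intro exI[of _ N0]) auto
    thus ?thesis by (rule tendsto_eventually)
  qed
  have bd_f: "\<bar>f N p\<bar> \<le> \<bar>?W p\<bar>" for N p by (simp add: f_def)
  note sm' = tendsto_infsum_dominated(1)[OF lim_f bd_f sm_W]
    and lim' = tendsto_infsum_dominated(2)[OF lim_f bd_f sm_W]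
  have "infsum (f N) UNIV = inverse (\<Prod>k<N. 1 - w k)" for N
  proof -
    have "(?W has_sum (\<Prod>k<N. inverse (1 - w k))) (?M N)"
      using w by (intro has_sum_multisets_finite) auto
    also have "?this \<longleftrightarrow> (f N has_sum (\<Prod>k<N. inverse (1 - w k))) UNIV"
      by (rule has_sum_cong_neutral) (auto simp: f_def)
    finally show ?thesis
      using infsumI prod_inversef[of "\<lambda>k. 1 - w k" "{..<N}"] by (force simp: o_def)
  qed
  hence "(\<lambda>N. infsum (f N) UNIV) \<longlonglongrightarrow> inverse (\<Prod>k. 1 - w k)"
    using lim[OF sm] pos[OF sm w] by (simp add: tendsto_inverse)
  hence "infsum ?W UNIV = inverse (\<Prod>k. 1 - w k)"
    using lim' LIMSEQ_unique by blast
  thus ?thesis using sm' by (simp add: summable_iff_has_sum_infsum)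
qed

text \<open>The multiset expansion with weights \<open>v k * x ^ k\<close>, grouped by the sum of
  the multiset. The condition \<open>v 0 = 0\<close> keeps the weight at 0 below 1 in absolute value
  and removes multisets containing 0.\<close>

theorem partition_generating_function:
  fixes v :: "nat \<Rightarrow> real" and x :: real
  assumes v: "\<And>k. \<bar>v k\<bar> \<le> 1" "v 0 = 0" and x: "0 < x" "x < 1"
  shows "(\<lambda>n. (\<Sum>p\<in>partitions_of n. \<Prod>k\<in>#p. v k) * x ^ n) sums inverse (\<Prod>k. 1 - v k * x ^ k)"
proof -
  have le: "\<bar>v k * x ^ k\<bar> \<le> x ^ k" for k
    using v(1)[of k] x by (simp add: abs_mult mult_left_le_one_le)
  have lt: "\<bar>v k * x ^ k\<bar> < 1" for k
  proof (cases "k = 0")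
    case False
    hence "x ^ k < 1" using x by (simp add: power_less_one_iff)
    thus ?thesis using le[of k] by linarith
  qed (simp add: v)
  have "summable (\<lambda>k. \<bar>v k * x ^ k\<bar>)"
    using le x by (intro summable_comparison_test'[OF summable_geometric[of x]]) auto
  hence "((\<lambda>p. \<Prod>k\<in>#p. v k * x ^ k) has_sum (inverse (\<Prod>k. 1 - v k * x ^ k))) UNIV"
    using lt by (intro has_sum_multisets)
  also have "?this \<longleftrightarrow> ((\<lambda>(n, p). (\<Prod>k\<in>#p. v k) * x ^ n) has_sum (inverse (\<Prod>k. 1 - v k * x ^ k)))
     (Sigma UNIV (\<lambda>n. {p. sum_mset p = n}))"
  proof (rule has_sum_reindex_bij_witness[where j = "\<lambda>p. (sum_mset p, p)" and i = snd], goal_cases)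
    case (5 p)
    show ?case by (induction p) (auto simp: power_add mult_ac)
  qed auto
  finally have *: "((\<lambda>(n, p). (\<Prod>k\<in>#p. v k) * x ^ n) has_sum (inverse (\<Prod>k. 1 - v k * x ^ k)))
     (Sigma UNIV (\<lambda>n. {p. sum_mset p = n}))" .
  have "((\<lambda>n. (\<Sum>p\<in>partitions_of n. \<Prod>k\<in>#p. v k) * x ^ n) has_sum (inverse (\<Prod>k. 1 - v k * x ^ k))) UNIV"
  proof (rule has_sum_SigmaD[OF *])
    fix n :: nat
    \<comment> \<open>Infinitely many multisets have sum n, because zeros may be added; all but the
      finitely many partitions have weight 0.\<close>
    have "(\<Prod>k\<in>#p. v k) = 0" if "0 \<in># p" for p
      using v(2) that by (auto simp: prod_mset_zero_iff)
    thus "((\<lambda>p. case (n, p) of (n, p) \<Rightarrow> (\<Prod>k\<in>#p. v k) * x ^ n) has_sum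
         (\<Sum>p\<in>partitions_of n. \<Prod>k\<in>#p. v k) * x ^ n) {p. sum_mset p = n}"
      by (intro has_sum_finite_neutralI[OF finite_partitions_of])
         (auto simp: partitions_of_def sum_distrib_right)
  qed
  thus ?thesis by (rule has_sum_imp_sums)
qed

text \<open>The weight is constant on each residue class, whose factors therefore form one symbol
  with base x^m.\<close>

lemma prodinf_periodic:
  fixes v :: "nat \<Rightarrow> real" and x :: real
  assumes v: "\<And>k. \<bar>v k\<bar> \<le> 1" "\<And>j r. v (m * j + r) = v r" and m: "m > 0" and x: "0 < x" "x < 1"
  shows "(\<Prod>k. 1 - v k * x ^ k) = (\<Prod>r<m. qpoch (v r * x ^ r) (x ^ m))"
proof -
  have "\<bar>v k * x ^ k\<bar> \<le> x ^ k" for k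
    using v(1)[of k] x by (simp add: abs_mult mult_left_le_one_le)
  hence "summable (\<lambda>k. \<bar>1 - v k * x ^ k - 1\<bar>)"
    using x by (intro summable_comparison_test'[OF summable_geometric[of x]]) auto
  from prodinf_split_mod[OF this m] show ?thesis
    unfolding v(2) qpoch_def by (simp add: power_add mult_ac flip: power_mult)
qed

text \<open>Zeros of a nonzero power series are isolated, whereas the difference series vanishes on
  all of (0,1).\<close>

lemma power_series_unique:
  fixes a b :: "nat \<Rightarrow> real"
  assumes a: "\<And>x. 0 < x \<Longrightarrow> x < 1 \<Longrightarrow> (\<lambda>n. a n * x ^ n) sums f x"
    and b: "\<And>x. 0 < x \<Longrightarrow> x < 1 \<Longrightarrow> (\<lambda>n. b n * x ^ n) sums f x"
  shows "a = b"
proof (rule ccontr)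
  assume "a \<noteq> b"
  define e where "e n = a n - b n" for n
  have e0: "(\<lambda>n. e n * x ^ n) sums 0" if "0 < x" "x < 1" for x
    using sums_diff[OF a[OF that] b[OF that]] by (simp add: e_def algebra_simps)
  define m where "m = (LEAST n. e n \<noteq> 0)"
  have m: "e m \<noteq> 0" "\<And>n. n < m \<Longrightarrow> e n = 0"
    using \<open>a \<noteq> b\<close> LeastI_ex[of "\<lambda>n. e n \<noteq> 0"] not_less_Least
    by (auto simp: e_def m_def fun_eq_iff)
  \<comment> \<open>Dividing by x^m and multiplying by x moves the first nonzero coefficient to
    index 1: \<open>powser_0_nonzero\<close> wants a series that vanishes at 0.\<close>
  define g where "g n = (if n = 0 then 0 else e (n - 1 + m))" for n
  have "(\<lambda>n. g n * x ^ n) sums 0" if "0 < x" "x < 1" for x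
  proof -
    have shifted: "(\<lambda>n. e (n + m) * x ^ (n + m)) sums 0"
      using sums_split_initial_segment[OF e0[OF that], of m] m by simp
    hence "(\<lambda>n. e (n + m) * x ^ (n + m) * (x / x ^ m)) sums 0"
      using sums_mult2[OF shifted, of "x / x ^ m"] by simp
    hence "(\<lambda>n. g (Suc n) * x ^ Suc n) sums 0"
      using that by (simp add: g_def power_add field_simps)
    thus ?thesis by (subst (asm) sums_Suc_iff) (simp add: g_def)
  qed note g0 = this
  have sums_g: "(\<lambda>n. g n * (x - 0) ^ n) sums (\<Sum>n. g n * x ^ n)" if "norm (x - 0) < 1 / 2" for x :: real
    using powser_inside[OF sums_summable[OF g0[of "1/2"]], of x] that by (auto intro: summable_sums)
  obtain s where s: "0 < s" "\<And>z. z \<in> cball 0 s - {0} \<Longrightarrow> (\<Sum>n. g n * z ^ n) \<noteq> 0"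
    by (rule powser_0_nonzero[of "1/2", OF _ sums_g, where m = 1]) (use m in \<open>auto simp: g_def\<close>)
  have "(\<Sum>n. g n * (min s (1/2)) ^ n) = 0"
    using g0[of "min s (1/2)"] s(1) by (simp add: sums_iff)
  thus False using s(2)[of "min s (1/2)"] s(1) by auto
qed

section \<open>6-regular partitions and partitions with parts modulo 48\<close>

lemma prod_mset_indicator:
  "(\<Prod>k\<in>#p. if P k then 1 else 0 :: real) = (if \<forall>k\<in>#p. P k then 1 else 0)"
  by (induction p) auto

lemma sum_indicator_partitions:
  "(\<Sum>p\<in>partitions_of n. if R p then 1 else 0 :: real) = real (card {p \<in> partitions_of n. R p})"
  using finite_partitions_of by (simp add: sum.If_cases Int_def)

text \<open>Products of such weights over the parts turn counts and signed counts of partitions into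
  coefficients of inverse infinite products.\<close>

definition avoid_weight :: "int \<Rightarrow> int set \<Rightarrow> nat \<Rightarrow> real" where
  "avoid_weight m R k = (if \<forall>r\<in>R. \<not> [int k = r] (mod m) then 1 else 0)"

definition parity_weight :: "nat \<Rightarrow> real" where
  "parity_weight k = (if 6 dvd k then 0 else if even k then -1 else 1)"

definition regular_weight :: "nat \<Rightarrow> real" where
  "regular_weight k = (if \<not> 6 dvd k then 1 else 0)"

lemma sum_avoid_weight:
  "(\<Sum>p\<in>partitions_of n. \<Prod>k\<in>#p. avoid_weight m R k) = real (card {p \<in> partitions_of n. parts_avoid m R p})"
  by (simp add: avoid_weight_def prod_mset_indicator sum_indicator_partitions parts_avoid_def)

lemma prod_mset_parity_weight:
  "(\<Prod>k\<in>#p. parity_weight k) = (if regular 6 p then (-1) ^ num_even_parts p else 0)"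
  by (induction p) (auto simp: regular_def parity_weight_def num_even_parts_def)

text \<open>For a 6-regular partition with e even parts, (1 + (-1)^e)/2 detects even e and (1 -
  (-1)^e)/2 detects odd e.\<close>

lemma b_ee_eq: "real (b_ee 6 n) = ((\<Sum>p\<in>partitions_of n. \<Prod>k\<in>#p. regular_weight k) + (\<Sum>p\<in>partitions_of n. \<Prod>k\<in>#p. parity_weight k)) / 2"
  and b_eo_eq: "real (b_eo 6 n) = ((\<Sum>p\<in>partitions_of n. \<Prod>k\<in>#p. regular_weight k) - (\<Sum>p\<in>partitions_of n. \<Prod>k\<in>#p. parity_weight k)) / 2"
  unfolding b_ee_def b_eo_def sum_indicator_partitions[symmetric] sum.distrib[symmetric] sum_subtractf[symmetric]
    sum_divide_distrib regular_weight_def prod_mset_indicator prod_mset_parity_weight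
  by (auto intro!: sum.cong simp: regular_def)

section \<open>Infinite products of the weights\<close>

context
  fixes x :: real
  assumes x: "0 < x" "x < 1"
begin

lemma qpoch_double:
  "qpoch (x ^ a) (x ^ m) = qpoch (x ^ a) (x ^ (2 * m)) * qpoch (x ^ (a + m)) (x ^ (2 * m))" if "m > 0"
  using qpoch_split[of "x ^ m" 2 "x ^ a"] x that
  by (simp add: numeral_2_eq_2 lessThan_Suc power_less_one_iff power_add mult_ac flip: power_mult)

lemma qpoch_self_split: "m > 0 \<Longrightarrow> qpoch x x = (\<Prod>r<m. qpoch (x ^ Suc r) (x ^ m))"
  using qpoch_split[of x m x] x by simp

text \<open>The weight removes from (x;x) exactly the factors of the multiples of 6.\<close>

lemma regular_weight_product:
  "(\<Prod>k. 1 - regular_weight k * x ^ k) * qpoch (x ^ 6) (x ^ 6) = qpoch x x"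
proof -
  have "(\<Prod>k. 1 - regular_weight k * x ^ k) = (\<Prod>r<6. qpoch (regular_weight r * x ^ r) (x ^ 6))"
    using x by (intro prodinf_periodic) (auto simp: regular_weight_def dvd_add_right_iff)
  thus ?thesis
    by (simp add: qpoch_self_split[of 6] lessThan_nat_numeral regular_weight_def mult_ac del: power_Suc flip: numeral_2_eq_2)
qed

text \<open>With y = x^2 the claim reduces to (-y,-y^2;y^3) (y,y^5;y^6) = 1, which is Euler's
  theorem on distinct and odd parts, restricted to parts not divisible by 3.\<close>

lemma parity_weight_product:
  "(\<Prod>k. 1 - parity_weight k * x ^ k) *
   (qpoch (x^6) (x^6) * qpoch (x\<^sup>2) (x^6) * qpoch (x^4) (x^6) * qpoch (x^10) (x^12) * qpoch (x\<^sup>2) (x^12)) = qpoch x x"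
proof -
  have "(\<Prod>k. 1 - parity_weight k * x ^ k) = (\<Prod>r<6. qpoch (parity_weight r * x ^ r) (x ^ 6))"
    using x by (intro prodinf_periodic) (auto simp: parity_weight_def dvd_add_right_iff)
  also have "\<dots> = qpoch (x ^ 1) (x ^ 6) * qpoch (- (x ^ 2)) (x ^ 6) * qpoch (x ^ 3) (x ^ 6) * qpoch (- (x ^ 4)) (x ^ 6) * qpoch (x ^ 5) (x ^ 6)"
    by (simp add: lessThan_nat_numeral parity_weight_def mult_ac del: power_Suc)
  finally have 1: "(\<Prod>k. 1 - parity_weight k * x ^ k) = \<dots>" .
  have 2: "qpoch x x = qpoch (x ^ 1) (x ^ 6) * qpoch (x ^ 2) (x ^ 6) * qpoch (x ^ 3) (x ^ 6) * qpoch (x ^ 4) (x ^ 6) * qpoch (x ^ 5) (x ^ 6) * qpoch (x ^ 6) (x ^ 6)"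
    by (simp add: qpoch_self_split[of 6] lessThan_nat_numeral mult_ac del: power_Suc flip: numeral_2_eq_2)
  have q: "0 \<le> x ^ 6" "x ^ 6 < 1" "0 \<le> x ^ 12" "x ^ 12 < 1" "x ^ 4 < 1" "x ^ 8 < 1"
    using x by (auto simp: power_less_one_iff)
  have m2: "qpoch (x ^ 2) (x ^ 6) * qpoch (- (x ^ 2)) (x ^ 6) = qpoch (x ^ 4) (x ^ 12)"
    and m4: "qpoch (x ^ 4) (x ^ 6) * qpoch (- (x ^ 4)) (x ^ 6) = qpoch (x ^ 8) (x ^ 12)"
    using qpoch_minus[OF q(1,2), of "x ^ 2"] qpoch_minus[OF q(1,2), of "x ^ 4"] by (simp_all flip: power_mult)
  have d2: "qpoch (x ^ 2) (x ^ 6) = qpoch (x ^ 2) (x ^ 12) * qpoch (x ^ 8) (x ^ 12)"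
    and d4: "qpoch (x ^ 4) (x ^ 6) = qpoch (x ^ 4) (x ^ 12) * qpoch (x ^ 10) (x ^ 12)"
    using qpoch_double[of 6 2] qpoch_double[of 6 4] by simp_all
  \<comment> \<open>These symbols are multiplied into the identity, so that negated and plain
    arguments pair up, and are then cancelled.\<close>
  have "qpoch (x ^ 4) (x ^ 12) > 0" "qpoch (x ^ 8) (x ^ 12) > 0"
    using q by (auto intro!: qpoch_pos)
  moreover have "qpoch (- (x ^ 2)) (x ^ 6) * qpoch (- (x ^ 4)) (x ^ 6) * qpoch (x ^ 10) (x ^ 12) * qpoch (x ^ 2) (x ^ 12)
     * (qpoch (x ^ 4) (x ^ 12) * qpoch (x ^ 8) (x ^ 12)) =
     (qpoch (x ^ 2) (x ^ 6) * qpoch (- (x ^ 2)) (x ^ 6)) * (qpoch (x ^ 4) (x ^ 6) * qpoch (- (x ^ 4)) (x ^ 6))"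
    unfolding d2 d4 by (simp add: mult_ac)
  ultimately have 3: "qpoch (- (x ^ 2)) (x ^ 6) * qpoch (- (x ^ 4)) (x ^ 6) * qpoch (x ^ 10) (x ^ 12) * qpoch (x ^ 2) (x ^ 12) = 1"
    unfolding m2 m4 by simp
  have "(\<Prod>k. 1 - parity_weight k * x ^ k) *
   (qpoch (x^6) (x^6) * qpoch (x\<^sup>2) (x^6) * qpoch (x^4) (x^6) * qpoch (x^10) (x^12) * qpoch (x\<^sup>2) (x^12))
    = qpoch x x * (qpoch (- (x ^ 2)) (x ^ 6) * qpoch (- (x ^ 4)) (x ^ 6) * qpoch (x ^ 10) (x ^ 12) * qpoch (x ^ 2) (x ^ 12))"
    unfolding 1 2 by (simp only: mult_ac)
  thus ?thesis using 3 by simp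
qed

lemma avoid_weight_product:
  "(\<Prod>k. 1 - avoid_weight 48 R k * x ^ k) = (\<Prod>r<48. qpoch (avoid_weight 48 R r * x ^ r) (x ^ 48))"
proof (rule prodinf_periodic)
  show "avoid_weight 48 R (48 * j + r) = avoid_weight 48 R r" for j r
    by (simp add: avoid_weight_def Cong.cong_def)
qed (use x in \<open>auto simp: avoid_weight_def\<close>)

text \<open>The factor consists of the forbidden classes: each base-24 symbol covers two classes
  modulo 48, namely 24 and 0, 2 and 26, 22 and 46; the remaining two are 28 and 20. Class 0 enters
  through the symbol starting at x^48.\<close>

lemma c_product:
  "(\<Prod>k. 1 - avoid_weight 48 {0, 2, -2, 20, -20, 22, -22, 24} k * x ^ k) *
   (qpoch (x^24) (x^24) * qpoch (x\<^sup>2) (x^24) * qpoch (x^22) (x^24) * qpoch (x^28) (x^48) * qpoch (x^20) (x^48)) = qpoch x x"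
  unfolding avoid_weight_product
  using qpoch_double[of 24 24] qpoch_double[of 24 2] qpoch_double[of 24 22]
  by (simp add: qpoch_self_split[of 48] lessThan_nat_numeral avoid_weight_def Cong.cong_def mult_ac
      del: power_Suc flip: numeral_2_eq_2)

text \<open>Likewise the base-24 symbols cover the forbidden classes 24 and 0, 10 and 34, 14 and 38;
  the remaining two are 44 and 4.\<close>

lemma d_product:
  "(\<Prod>k. 1 - avoid_weight 48 {0, 4, -4, 10, -10, 14, -14, 24} k * x ^ k) *
   (qpoch (x^24) (x^24) * qpoch (x^10) (x^24) * qpoch (x^14) (x^24) * qpoch (x^44) (x^48) * qpoch (x^4) (x^48)) = qpoch x x"
  unfolding avoid_weight_product
  using qpoch_double[of 24 24] qpoch_double[of 24 10] qpoch_double[of 24 14]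
  by (simp add: qpoch_self_split[of 48] lessThan_nat_numeral avoid_weight_def Cong.cong_def mult_ac
      del: power_Suc flip: numeral_2_eq_2)

end

theorem corollary1p7:
  fixes n :: nat
  shows "c n = b_ee 6 n \<and> d n = b_eo 6 (n + 2)"
proof -
  define P Q R h where "P x = qpoch (x^24) (x^24) * qpoch (x\<^sup>2) (x^24) * qpoch (x^22) (x^24) * qpoch (x^28) (x^48) * qpoch (x^20) (x^48)"
    and "Q x = qpoch (x^24) (x^24) * qpoch (x^10) (x^24) * qpoch (x^14) (x^24) * qpoch (x^44) (x^48) * qpoch (x^4) (x^48)"
    and "R x = qpoch (x^6) (x^6) * qpoch (x\<^sup>2) (x^6) * qpoch (x^4) (x^6) * qpoch (x^10) (x^12) * qpoch (x\<^sup>2) (x^12)"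
    and "h x = qpoch (x^6) (x^6)" for x :: real
  define u s where "u n = (\<Sum>p\<in>partitions_of n. \<Prod>k\<in>#p. regular_weight k)"
    and "s n = (\<Sum>p\<in>partitions_of n. \<Prod>k\<in>#p. parity_weight k)" for n
  \<comment> \<open>Shifting by two, with zeros in front, multiplies the generating function of
    \<open>d\<close> by x^2.\<close>
  define d' where "d' n = (if n < 2 then 0 else real (d (n - 2)))" for n
  \<comment> \<open>Here t is the product complementary to that of the weights inside (x;x), so the
    inverse product becomes t / (x;x).\<close>
  have gf: "(\<lambda>n. (\<Sum>p\<in>partitions_of n. \<Prod>k\<in>#p. v k) * x ^ n) sums (t / qpoch x x)"
    if "\<And>k. \<bar>v k\<bar> \<le> 1" "v 0 = 0" "0 < x" "x < 1" "(\<Prod>k. 1 - v k * x ^ k) * t = qpoch x x" for v x t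
  proof -
    have "qpoch x x > 0" using that by (intro qpoch_pos) auto
    hence "(\<Prod>k. 1 - v k * x ^ k) \<noteq> 0" "t \<noteq> 0" using that(5) by auto
    hence "inverse (\<Prod>k. 1 - v k * x ^ k) = t / qpoch x x"
      unfolding that(5)[symmetric] by (simp add: field_simps)
    thus ?thesis using partition_generating_function[of v x] that by simp
  qed
  have u: "(\<lambda>n. u n * x ^ n) sums ((P x + x\<^sup>2 * Q x) / qpoch x x)"
    and s: "(\<lambda>n. s n * x ^ n) sums ((P x - x\<^sup>2 * Q x) / qpoch x x)"
    and c: "(\<lambda>n. real (c n) * x ^ n) sums (P x / qpoch x x)"
    and d: "(\<lambda>n. real (d n) * x ^ n) sums (Q x / qpoch x x)"
    if x: "0 < x" "x < 1" for x
  proof -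
    note theta = theta_identities[OF x, folded P_def Q_def R_def h_def]
    show "(\<lambda>n. u n * x ^ n) sums ((P x + x\<^sup>2 * Q x) / qpoch x x)"
      unfolding u_def theta(1)
      by (rule gf) (use x regular_weight_product[OF x] in \<open>auto simp: regular_weight_def h_def\<close>)
    show "(\<lambda>n. s n * x ^ n) sums ((P x - x\<^sup>2 * Q x) / qpoch x x)"
      unfolding s_def theta(2)
      by (rule gf) (use x parity_weight_product[OF x] in \<open>auto simp: parity_weight_def R_def\<close>)
    show "(\<lambda>n. real (c n) * x ^ n) sums (P x / qpoch x x)"
      unfolding c_def sum_avoid_weight[symmetric]
      by (rule gf) (use x c_product[OF x] in \<open>auto simp: avoid_weight_def P_def\<close>)
    show "(\<lambda>n. real (d n) * x ^ n) sums (Q x / qpoch x x)"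
      unfolding d_def sum_avoid_weight[symmetric]
      by (rule gf) (use x d_product[OF x] in \<open>auto simp: avoid_weight_def Q_def\<close>)
  qed
  have "(\<lambda>n. real (b_ee 6 n) * x ^ n) sums (P x / qpoch x x)" if "0 < x" "x < 1" for x
    using sums_divide[OF sums_add[OF u[OF that] s[OF that]], of 2]
    by (simp add: b_ee_eq u_def s_def algebra_simps flip: add_divide_distrib)
  hence "(\<lambda>n. real (c n)) = (\<lambda>n. real (b_ee 6 n))"
    using c by (intro power_series_unique)
  hence c_eq: "c n = b_ee 6 n" by (metis of_nat_eq_iff)
  have b_eo: "(\<lambda>n. real (b_eo 6 n) * x ^ n) sums (x\<^sup>2 * Q x / qpoch x x)" if "0 < x" "x < 1" for x
    using sums_divide[OF sums_diff[OF u[OF that] s[OF that]], of 2]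
    by (simp add: b_eo_eq u_def s_def algebra_simps flip: diff_divide_distrib)
  have d': "(\<lambda>n. d' n * x ^ n) sums (x\<^sup>2 * Q x / qpoch x x)" if "0 < x" "x < 1" for x
  proof -
    have "(\<lambda>n. d' (n + 2) * x ^ (n + 2)) sums (x\<^sup>2 * Q x / qpoch x x)"
      using sums_mult[OF d[OF that], of "x\<^sup>2"] by (simp add: d'_def power2_eq_square mult_ac)
    thus ?thesis by (subst (asm) sums_zero_iff_shift) (auto simp: d'_def)
  qed
  have "d' = (\<lambda>n. real (b_eo 6 n))"
    using d' b_eo by (intro power_series_unique)
  hence "d' (n + 2) = real (b_eo 6 (n + 2))" by simp
  hence "d n = b_eo 6 (n + 2)" by (simp add: d'_def)
  with c_eq show ?thesis ..
qed

end
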